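(* Let $n=1$ and $d=3$. There exist right simplices $\mathcal{P}_0,\mathcal{P}_1\subset\mathbb{R}^3$ that are related by a point reflection (i.e., there is a point $p\in\mathbb{R}^3$ with $\mathcal{P}_1=\{2p-x : x\in\mathcal{P}_0\}$) such that $\mathcal{D}\subset\mathbb{R}^4$ has a vertical facet that is not described by the full optimal big-M lifting of any facet-describing inequality of $\mathcal{P}_0$ or $\mathcal{P}_1$.
   Context: For polytopes $\mathcal{P}_0,\mathcal{P}_1\subset\mathbb{R}^d$, with points of $\mathbb{R}^{d+1}$ written $\begin{pmatrix}x\\ z_1\end{pmatrix}$, $x\in\mathbb{R}^d$, $z_1\in\mathbb{R}$, let $$\mathcal{D}:=\operatorname{conv}\left(\left\{\begin{pmatrix}x\\ 0\end{pmatrix} : x\in\mathcal{P}_0\right\}\cup\left\{\begin{pmatrix}x\\ 1\end{pmatrix} : x\in\mathcal{P}_1\right\}\right)\subset\mathbb{R}^{d+1}.$$ A vertical facet of $\mathcal{D}$ is a facet of $\mathcal{D}$ other than those described by $z_1\ge 0$ and $z_1\le 1$. A right simplex in $\mathbb{R}^3$ is a (full-dimensional) simplex having a vertex at which the incident edges are pairwise orthogonal. The face described by an inequality valid for a polytope is the set of points of the polytope satisfying it with equality; a facet is a face of dimension one less than that of the polytope; a facet-describing inequality is a valid inequality whose described face is a facet. Full optimal big-M lifting (case $n=1$): if $\alpha^\top x\le\beta$ is valid for $\mathcal{P}_0$, put $M_1:=\min\{\beta-\alpha^\top x : x\in\mathcal{P}_1\}$, and its full optimal big-M lifting is $\alpha^\top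 x+M_1z_1\le\beta$. If $\alpha^\top x\le\beta$ is valid for $\mathcal{P}_1$, put $M_0:=\min\{\beta-\alpha^\top x : x\in\mathcal{P}_0\}$, and its full optimal big-M lifting is $\alpha^\top x-M_0z_1\le\beta-M_0$. *)

theory Defs
  imports "HOL-Analysis.Analysis"
begin

(* A linear inequality  a \<bullet> x \<le> b  is represented by the pair (a, b). *)

fun valid_ineq :: "'a::euclidean_space set \<Rightarrow> 'a \<times> real \<Rightarrow> bool" where
  "valid_ineq P (a, b) \<longleftrightarrow> (\<forall>x\<in>P. a \<bullet> x \<le> b)"

fun described_face :: "'a::euclidean_space set \<Rightarrow> 'a \<times> real \<Rightarrow> 'a set" where
  "described_face P (a, b) = {x \<in> P. a \<bullet> x = b}"

definition facet_describing :: "'a::euclidean_space set \<Rightarrow> 'a \<times> real \<Rightarrow> bool" where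
  "facet_describing P i \<longleftrightarrow> valid_ineq P i \<and> described_face P i facet_of P"

(* The library's facet_of is phrased with general faces of convex sets; on polytopes
   its facets are exactly those described by valid inequalities. *)
lemma facet_of_polytope_iff_described:
  assumes "polytope P"
  shows "F facet_of P \<longleftrightarrow> (\<exists>i. facet_describing P i \<and> F = described_face P i)"
proof
  assume F: "F facet_of P"
  then have "F exposed_face_of P"
    using assms exposed_face_of_polyhedron facet_of_imp_face_of polytope_imp_polyhedron by blast
  then obtain a b where ab: "P \<subseteq> {x. a \<bullet> x \<le> b}" "F = P \<inter> {x. a \<bullet> x = b}"
    unfolding exposed_face_of_def by blast
  have "valid_ineq P (a, b)" "F = described_face P (a, b)"
    using ab by auto
  then show "\<exists>i. facet_describing P i \<and> F = described_face P i"
    using F unfolding facet_describing_def by blast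
qed (auto simp: facet_describing_def)

definition right_simplex :: "(real^3) set \<Rightarrow> bool" where
  "right_simplex S \<longleftrightarrow> 3 simplex S \<and>
     (\<exists>v. v extreme_point_of S \<and>
       (\<forall>E E'. E edge_of S \<and> E' edge_of S \<and> v \<in> E \<and> v \<in> E' \<and> E \<noteq> E' \<longrightarrow>
         (\<forall>x\<in>E. \<forall>y\<in>E'. orthogonal (x - v) (y - v))))"

(* The point with coordinates x and z_1 is the pair (x, z_1); the inner product of the
   product type is  (a, m) \<bullet> (x, z) = a \<bullet> x + m * z. *)
definition cayley_polytope ::
    "'a::euclidean_space set \<Rightarrow> 'a set \<Rightarrow> ('a \<times> real) set" where
  "cayley_polytope P0 P1 = convex hull (P0 \<times> {0} \<union> P1 \<times> {1})"

(* The two excluded facets are those described by  - z_1 \<le> 0  and  z_1 \<le> 1. *)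
definition vertical_facet ::
    "'a::euclidean_space set \<Rightarrow> 'a set \<Rightarrow> ('a \<times> real) set \<Rightarrow> bool" where
  "vertical_facet P0 P1 F \<longleftrightarrow>
     F facet_of cayley_polytope P0 P1 \<and>
     F \<noteq> described_face (cayley_polytope P0 P1) ((0, -1), 0) \<and>
     F \<noteq> described_face (cayley_polytope P0 P1) ((0, 1), 1)"

(* M_1 and M_0 in the paper's notation are big_M P1 (a, b) for an inequality valid for P0,
   and big_M P0 (a, b) for one valid for P1. The infimum is a minimum when Q is a
   nonempty polytope. *)
fun big_M :: "'a::euclidean_space set \<Rightarrow> 'a \<times> real \<Rightarrow> real" where
  "big_M Q (a, b) = (INF x\<in>Q. b - a \<bullet> x)"

(* Lifting of an inequality valid for P0:  a \<bullet> x + M_1 z_1 \<le> b. *)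
fun full_lifting0 :: "'a::euclidean_space set \<Rightarrow> 'a \<times> real \<Rightarrow> ('a \<times> real) \<times> real" where
  "full_lifting0 P1 (a, b) = ((a, big_M P1 (a, b)), b)"

(* Lifting of an inequality valid for P1:  a \<bullet> x - M_0 z_1 \<le> b - M_0. *)
fun full_lifting1 :: "'a::euclidean_space set \<Rightarrow> 'a \<times> real \<Rightarrow> ('a \<times> real) \<times> real" where
  "full_lifting1 P0 (a, b) = ((a, - big_M P0 (a, b)), b - big_M P0 (a, b))"

end

theory Submission
  imports Defs
begin

text \<open>
  Every right simplex yields an example; the standard simplex \<open>P0\<close>, with vertices \<open>0, e1, e2, e3\<close>,
  and its reflection \<open>P1 = - P0\<close> in the origin keep the computation short.

  A linear functional attains its maximum over \<open>P1\<close> at the reflected face on which it attains its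
  minimum over \<open>P0\<close>. The functional \<open>- x2 - x3\<close> is maximal on \<open>P0\<close> exactly along the edge from \<open>0\<close>
  to \<open>e1\<close>, with value \<open>0\<close>, and minimal exactly along the opposite edge from \<open>e2\<close> to \<open>e3\<close>, so that
  it is maximal on \<open>P1\<close> along the edge from \<open>- e2\<close> to \<open>- e3\<close>, with value \<open>1\<close>. Hence
  \<open>- x2 - x3 - z \<le> 0\<close> is valid for the Cayley polytope and describes the join of these two edges,
  placed at heights \<open>0\<close> and \<open>1\<close>. As opposite edges of a tetrahedron are skew, this join is
  three-dimensional, that is, a facet, and it is vertical since it has points at both heights.

  On the other hand, a full optimal big-M lifting agrees with the original inequality at the height
  of the polytope for which that inequality is valid, whatever the value of the big-M constant. The
  face described by the lifting of a facet-describing inequality therefore contains a whole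
  two-dimensional facet at height \<open>0\<close> or \<open>1\<close>, whereas the join meets both heights in an edge only.
\<close>

section \<open>Simplices spanned by orthogonal vectors\<close>

lemma affine_independent_insert_0:
  fixes B :: "'a::euclidean_space set"
  assumes "independent B"
  shows "\<not> affine_dependent (insert 0 B)"
  using assms affine_dependent_iff_dependent[of 0 B] dependent_zero by auto

text \<open>
  The faces of a simplex are the hulls of sets of its vertices, so an edge has two of them as ends.
  A vertex lying on the edge is extreme in it and hence is one of the two.
\<close>

lemma edge_of_simplex_at_0:
  fixes B :: "'a::euclidean_space set"
  assumes "independent B" "E edge_of convex hull (insert 0 B)" "0 \<in> E"
  obtains s where "s \<in> B" "E = closed_segment 0 s"
proof -
  have indep: "\<not> affine_dependent (insert 0 B)"
    using assms(1) by (rule affine_independent_insert_0)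
  from assms(2) have face: "E face_of convex hull (insert 0 B)" and dim: "aff_dim E = 1"
    by (auto simp: edge_of_def)
  then obtain c where c: "c \<subseteq> insert 0 B" "E = convex hull c"
    using face_of_convex_hull_affine_independent[OF indep] by blast
  have ci: "\<not> affine_dependent c"
    using indep c(1) affine_independent_subset by blast
  have "card c = 2"
    using dim c(2) aff_dim_affine_independent[OF ci] by (simp add: aff_dim_convex_hull)
  moreover have "0 extreme_point_of convex hull (insert 0 B)"
    using extreme_point_of_convex_hull_affine_independent[OF indep] by blast
  then have "0 \<in> c"
    using extreme_point_of_face[OF face] assms(3) c(2) extreme_point_of_convex_hull by blast
  ultimately obtain s where "s \<noteq> 0" "c = {0, s}"
    by (metis card_2_iff doubleton_eq_iff insertE singletonD)
  with c that show thesis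
    by (auto simp: segment_convex_hull)
qed

text \<open>
  The edges at the vertex \<open>0\<close> run along the vectors of \<open>B\<close>, so that their orthogonality is that of
  \<open>B\<close>.
\<close>

lemma right_simplex_orthogonal:
  fixes B :: "(real^3) set"
  assumes "pairwise orthogonal B" "0 \<notin> B" "card B = 3"
  shows "right_simplex (convex hull (insert 0 B))"
proof -
  have indep: "independent B"
    using assms pairwise_orthogonal_independent by blast
  note aff = affine_independent_insert_0[OF indep]
  have "finite B"
    using assms(3) card.infinite by fastforce
  with assms have "card (insert 0 B) = 4"
    by simp
  then have "3 simplex (convex hull (insert 0 B))"
    using aff unfolding simplex_def by fastforce
  moreover have "0 extreme_point_of convex hull (insert 0 B)"
    using extreme_point_of_convex_hull_affine_independent[OF aff] by blast
  moreover have "orthogonal (x - 0) (y - 0)"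
    if E: "E edge_of convex hull (insert 0 B)" "E' edge_of convex hull (insert 0 B)"
      "0 \<in> E" "0 \<in> E'" "E \<noteq> E'" "x \<in> E" "y \<in> E'" for E E' x y
  proof -
    obtain s where s: "s \<in> B" "E = closed_segment 0 s"
      using edge_of_simplex_at_0[OF indep E(1,3)] .
    obtain t where t: "t \<in> B" "E' = closed_segment 0 t"
      using edge_of_simplex_at_0[OF indep E(2,4)] .
    have "orthogonal s t"
      using pairwiseD[OF assms(1)] E(5) s t by metis
    then show ?thesis
      using E(6,7) \<open>orthogonal s t\<close> s t by (auto simp: in_segment orthogonal_def)
  qed
  ultimately show ?thesis
    unfolding right_simplex_def by blast
qed

section \<open>Liftings and the faces they describe\<close>

text \<open>
  At height \<open>0\<close> the big-M term vanishes, and at height \<open>1\<close> the two occurrences of the big-M constant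
  cancel, which leaves the original inequality in both cases.
\<close>

lemma described_face_full_lifting0:
  "described_face P0 i \<times> {0} \<subseteq>
     described_face (cayley_polytope P0 P1) (full_lifting0 P1 i)"
  by (cases i) (auto simp: cayley_polytope_def intro: hull_inc)

lemma described_face_full_lifting1:
  "described_face P1 i \<times> {1} \<subseteq>
     described_face (cayley_polytope P0 P1) (full_lifting1 P0 i)"
  by (cases i) (auto simp: cayley_polytope_def intro: hull_inc)

text \<open>
  Since a proper face of a convex set has smaller dimension than the set, a proper face of dimension
  at least \<open>n - 1\<close> in \<open>n\<close>-dimensional space forces the set to be full-dimensional. The dimension of
  \<open>P\<close> thus comes for free from that of the face.
\<close>

lemma described_face_facet_of:
  fixes P :: "'a::euclidean_space set"
  assumes "convex P" "valid_ineq P i"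
    and large: "aff_dim (described_face P i) \<ge> int DIM('a) - 1"
    and proper: "described_face P i \<noteq> P"
  shows "described_face P i facet_of P"
proof -
  obtain a b where i: "i = (a, b)"
    by (cases i)
  have "described_face P i = P \<inter> {x. a \<bullet> x = b}"
    by (auto simp: i)
  then have face: "described_face P i face_of P"
    using face_of_Int_supporting_hyperplane_le[OF assms(1)] assms(2) by (auto simp: i)
  have "aff_dim (described_face P i) < aff_dim P"
    using face_of_aff_dim_lt[OF assms(1) face proper] .
  moreover have "aff_dim P \<le> DIM('a)"
    by (rule aff_dim_le_DIM)
  moreover have "described_face P i \<noteq> {}"
    using large DIM_positive[where 'a='a] aff_dim_empty[of "described_face P i"] by linarith
  ultimately show ?thesis
    using face large unfolding facet_of_def by auto
qed

lemma facet_not_within_line: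
  assumes "right_simplex P" "facet_describing P i"
  shows "\<not> described_face P i \<subseteq> affine hull {x, y}"
proof
  assume "described_face P i \<subseteq> affine hull {x, y}"
  then have "aff_dim (described_face P i) \<le> aff_dim {x, y}"
    by (metis aff_dim_affine_hull aff_dim_subset)
  moreover have "aff_dim {x, y} \<le> 1"
    by (simp add: aff_dim_2)
  moreover have "aff_dim P = 3"
    using assms(1) aff_dim_simplex[of 3 P] by (simp add: right_simplex_def)
  then have "aff_dim (described_face P i) = 2"
    using assms(2) unfolding facet_describing_def facet_of_def by simp
  ultimately show False
    by simp
qed

section \<open>The standard simplex and its reflection\<close>

abbreviation std_simplex :: "(real^3) set" where
  "std_simplex \<equiv> convex hull (insert 0 Basis)"

abbreviation reflected_simplex :: "(real^3) set" where
  "reflected_simplex \<equiv> convex hull (insert 0 (uminus ` Basis))"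

lemma Basis_3: "(Basis :: (real^3) set) = {axis 1 1, axis 2 1, axis 3 1}"
  unfolding Basis_vec_def by (auto simp: UNIV_3)

lemma mem_std_simplex:
  "x \<in> std_simplex \<longleftrightarrow> 0 \<le> x$1 \<and> 0 \<le> x$2 \<and> 0 \<le> x$3 \<and> x$1 + x$2 + x$3 \<le> 1"
  unfolding std_simplex by (simp add: Basis_3 inner_axis axis_eq_axis add.assoc)

lemma reflected_simplex_eq: "reflected_simplex = uminus ` std_simplex"
  using convex_hull_linear_image[of "uminus :: real^3 \<Rightarrow> real^3" "insert 0 Basis"]
  by (simp add: linear_uminus)

lemma mem_reflected_simplex: "x \<in> reflected_simplex \<longleftrightarrow> - x \<in> std_simplex"
  unfolding reflected_simplex_eq by (auto intro: image_eqI[of x uminus "- x"])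

lemma right_simplex_std_simplex: "right_simplex std_simplex"
  by (rule right_simplex_orthogonal)
    (auto simp: pairwise_def orthogonal_def inner_not_same_Basis)

lemma right_simplex_reflected_simplex: "right_simplex reflected_simplex"
  by (rule right_simplex_orthogonal)
    (auto simp: pairwise_def orthogonal_def inner_not_same_Basis card_image)

section \<open>The join of two opposite edges\<close>

abbreviation cayley :: "((real^3) \<times> real) set" where
  "cayley \<equiv> cayley_polytope std_simplex reflected_simplex"

definition opposite_edges_ineq :: "((real^3) \<times> real) \<times> real" where
  "opposite_edges_ineq = ((- axis 2 1 - axis 3 1, -1), 0)"

definition opposite_edges_join :: "((real^3) \<times> real) set" where
  "opposite_edges_join = described_face cayley opposite_edges_ineq"

lemma mem_opposite_edges_join:
  "(x, z) \<in> opposite_edges_join \<longleftrightarrow> (x, z) \<in> cayley \<and> x$2 + x$3 + z = 0"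
  unfolding opposite_edges_join_def opposite_edges_ineq_def
  by (auto simp: inner_diff_left inner_axis')

lemma in_cayley:
  "x \<in> std_simplex \<Longrightarrow> (x, 0) \<in> cayley"
  "x \<in> reflected_simplex \<Longrightarrow> (x, 1) \<in> cayley"
  unfolding cayley_polytope_def by (auto intro: hull_inc)

lemma vertices_in_opposite_edges_join:
  "(0, 0) \<in> opposite_edges_join" "(axis 1 1, 0) \<in> opposite_edges_join"
  "(- axis 2 1, 1) \<in> opposite_edges_join" "(- axis 3 1, 1) \<in> opposite_edges_join"
  unfolding mem_opposite_edges_join
  by (auto intro!: in_cayley simp: mem_std_simplex mem_reflected_simplex axis_def)

lemma valid_opposite_edges_ineq: "valid_ineq cayley opposite_edges_ineq"
proof -
  let ?n = "(- axis 2 1 - axis 3 1, -1) :: (real^3) \<times> real"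
  have "cayley \<subseteq> {q. ?n \<bullet> q \<le> 0}"
    unfolding cayley_polytope_def
  proof (rule hull_minimal)
    show "std_simplex \<times> {0} \<union> reflected_simplex \<times> {1} \<subseteq> {q. ?n \<bullet> q \<le> 0}"
      by (auto simp: mem_std_simplex mem_reflected_simplex inner_diff_left inner_axis')
  qed (rule convex_halfspace_le)
  then show ?thesis
    unfolding opposite_edges_ineq_def by auto
qed

text \<open>
  The face contains the origin, so its dimension is that of its linear span, and three nonzero
  pairwise orthogonal vectors in the span suffice.
\<close>

lemma aff_dim_opposite_edges_join: "aff_dim opposite_edges_join \<ge> 3"
proof -
  \<comment> \<open>The second and third vector are the difference and the sum of the two vertices at height \<open>1\<close>;
    unlike these vertices, they are orthogonal.\<close>
  let ?u = "(axis 1 1, 0) :: (real^3) \<times> real"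
  let ?v = "(axis 3 1 - axis 2 1, 0) :: (real^3) \<times> real"
  let ?w = "(- axis 2 1 - axis 3 1, 2) :: (real^3) \<times> real"
  let ?B = "{?u, ?v, ?w}"
  let ?S = "span opposite_edges_join"
  have "pairwise orthogonal ?B"
    by (auto simp: pairwise_def orthogonal_def inner_diff_left inner_diff_right inner_axis_axis)
  moreover have "0 \<notin> ?B"
    by (auto simp: zero_prod_def axis_eq_axis)
  ultimately have "independent ?B"
    using pairwise_orthogonal_independent by blast
  moreover have "?B \<subseteq> ?S"
  proof -
    have "?u \<in> ?S" "(- axis 2 1, 1) \<in> ?S" "(- axis 3 1, 1) \<in> ?S"
      using vertices_in_opposite_edges_join by (simp_all add: span_base)
    moreover from this(2,3) have "?v \<in> ?S" "?w \<in> ?S"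
      using span_diff[of "(- axis 2 1, 1)" opposite_edges_join "(- axis 3 1, 1)"]
        span_add[of "(- axis 2 1, 1)" opposite_edges_join "(- axis 3 1, 1)"]
      by simp_all
    ultimately show ?thesis
      by simp
  qed
  ultimately have "card ?B \<le> dim ?S"
    by (rule independent_card_le_dim[rotated])
  moreover have "card ?B = 3"
    by (simp add: axis_eq_axis vec_eq_iff forall_3 axis_def)
  moreover have "aff_dim opposite_edges_join = dim opposite_edges_join"
    using vertices_in_opposite_edges_join(1)
    by (intro aff_dim_zero hull_inc) (simp add: zero_prod_def)
  ultimately show ?thesis
    by simp
qed

lemma vertical_facet_opposite_edges_join:
  "vertical_facet std_simplex reflected_simplex opposite_edges_join"
proof -
  have "(axis 2 1, 0) \<in> cayley - opposite_edges_join"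
    unfolding Diff_iff mem_opposite_edges_join
    by (auto intro!: in_cayley simp: mem_std_simplex axis_def)
  then have "opposite_edges_join facet_of cayley"
    using aff_dim_opposite_edges_join valid_opposite_edges_ineq
    unfolding opposite_edges_join_def
    by (intro described_face_facet_of) (auto simp: cayley_polytope_def convex_convex_hull)
  moreover have "(- axis 2 1, 1) \<notin> described_face cayley ((0, -1), 0)"
    by simp
  then have "opposite_edges_join \<noteq> described_face cayley ((0, -1), 0)"
    using vertices_in_opposite_edges_join(3) by metis
  moreover have "(0, 0) \<notin> described_face cayley ((0, 1), 1)"
    by simp
  then have "opposite_edges_join \<noteq> described_face cayley ((0, 1), 1)"
    using vertices_in_opposite_edges_join(1) by metis
  ultimately show ?thesis
    unfolding vertical_facet_def by blast
qed

text \<open>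
  This and its counterpart at height \<open>1\<close> keep the face too thin at both heights to contain a
  two-dimensional facet of either simplex.
\<close>

lemma opposite_edges_join_at_0:
  assumes "x \<in> std_simplex" "(x, 0) \<in> opposite_edges_join"
  shows "x \<in> affine hull {0, axis 1 1}"
proof -
  have "x$2 = 0" "x$3 = 0"
    using assms by (auto simp: mem_std_simplex mem_opposite_edges_join)
  then have "x = (1 - x$1) *\<^sub>R 0 + x$1 *\<^sub>R axis 1 1"
    by (simp add: vec_eq_iff forall_3 axis_def)
  then show ?thesis
    unfolding affine_hull_2 by (smt (verit) mem_Collect_eq)
qed

lemma opposite_edges_join_at_1:
  assumes "x \<in> reflected_simplex" "(x, 1) \<in> opposite_edges_join"
  shows "x \<in> affine hull {- axis 2 1, - axis 3 1}"
proof -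
  have x: "x$1 = 0" "- x$2 + - x$3 = 1"
    using assms by (auto simp: mem_reflected_simplex mem_std_simplex mem_opposite_edges_join)
  then have "x = (- x$2) *\<^sub>R (- axis 2 1) + (- x$3) *\<^sub>R (- axis 3 1)"
    by (simp add: vec_eq_iff forall_3 axis_def)
  with x(2) show ?thesis
    unfolding affine_hull_2 by blast
qed

theorem proposition9:
  "\<exists>P0 P1 :: (real^3) set.
     right_simplex P0 \<and> right_simplex P1 \<and>
     (\<exists>p. P1 = {2 *\<^sub>R p - x | x. x \<in> P0}) \<and>
     (\<exists>F. vertical_facet P0 P1 F \<and>
        (\<forall>i. facet_describing P0 i \<longrightarrow>
             F \<noteq> described_face (cayley_polytope P0 P1) (full_lifting0 P1 i)) \<and>
        (\<forall>i. facet_describing P1 i \<longrightarrow>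
             F \<noteq> described_face (cayley_polytope P0 P1) (full_lifting1 P0 i)))"
proof -
  have "reflected_simplex = {2 *\<^sub>R 0 - x | x. x \<in> std_simplex}"
    unfolding reflected_simplex_eq by auto
  moreover have "opposite_edges_join \<noteq> described_face cayley (full_lifting0 reflected_simplex i)"
    if "facet_describing std_simplex i" for i
  proof
    assume "opposite_edges_join = described_face cayley (full_lifting0 reflected_simplex i)"
    then have "described_face std_simplex i \<times> {0} \<subseteq> opposite_edges_join"
      using described_face_full_lifting0 by metis
    moreover have "described_face std_simplex i \<subseteq> std_simplex"
      by (cases i) auto
    ultimately have "described_face std_simplex i \<subseteq> affine hull {0, axis 1 1}"
      using opposite_edges_join_at_0 by blast
    then show False
      using facet_not_within_line[OF right_simplex_std_simplex that] by blast
  qed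
  moreover have "opposite_edges_join \<noteq> described_face cayley (full_lifting1 std_simplex i)"
    if "facet_describing reflected_simplex i" for i
  proof
    assume "opposite_edges_join = described_face cayley (full_lifting1 std_simplex i)"
    then have "described_face reflected_simplex i \<times> {1} \<subseteq> opposite_edges_join"
      using described_face_full_lifting1 by metis
    moreover have "described_face reflected_simplex i \<subseteq> reflected_simplex"
      by (cases i) auto
    ultimately have "described_face reflected_simplex i \<subseteq> affine hull {- axis 2 1, - axis 3 1}"
      using opposite_edges_join_at_1 by blast
    then show False
      using facet_not_within_line[OF right_simplex_reflected_simplex that] by blast
  qed
  ultimately show ?thesis
    using right_simplex_std_simplex right_simplex_reflected_simplex
      vertical_facet_opposite_edges_join
    by blast
qed

end
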